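(* If $C\in\ell_{00}^{(d+1)\times(d+1)}(\mathbb{Z})$ is such that $C*V_{d,\Lambda}=0$, i.e. $C*v_f=0$ for all $f\in V_{d,\Lambda}$, then there exists a finitely supported mask $B\in\ell_{00}^{(d+1)\times(d+1)}(\mathbb{Z})$ such that $C=B*H_{d,\Lambda}$.
   Context: Sequences and operators. $\ell^{m}(\mathbb{Z})$ and $\ell^{m\times m}(\mathbb{Z})$ denote the spaces of all sequences indexed by $\mathbb{Z}$ of $m$-vectors and of $m\times m$ matrices; the subscript $00$ means finitely supported. Masks are real matrix valued; vector sequences may be complex valued (when imaginary frequencies occur). The symbol of $A\in\ell_{00}^{m\times m}(\mathbb{Z})$ is $A^*(z)=\sum_{\alpha\in\mathbb{Z}}A(\alpha)z^\alpha$. Convolution is $(A*B)(\alpha)=\sum_{\beta\in\mathbb{Z}}A(\beta)B(\alpha-\beta)$ for matrix sequences and, likewise, $(A*c)(\alpha)=\sum_{\beta}A(\beta)c(\alpha-\beta)$ for $c\in\ell^m(\mathbb{Z})$. Function space. Let $p\ge 0$, $r\ge 1$ be integers, $d=p+2r$, and $\Lambda=\{\lambda_1,\dots,\lambda_r\}\subset\mathbb{R}\cup i\mathbb{R}$ with all $\lambda_j\neq0$ and $\lambda_i\neq\pm\lambda_j$ for $i\ne j$. Put $V_{d,\Lambda}=\mathrm{span}\{1,x,\dots,x^p,e^{\pm\lambda_1x},\dots,e^{\pm\lambda_rx}\}$. For a $d$ times continuously differentiable $f$, $v_f\in\ell^{d+1}(\mathbb{Z})$ is $v_f(\alpha)=[f(\alpha),f'(\alpha),\dots,f^{(d)}(\alpha)]^T$.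 The impulse response $H_{d,\Lambda}\in\ell_{00}^{(d+1)\times(d+1)}(\mathbb{Z})$ has symbol (rows and columns indexed $0,\dots,d$) $$H_{d,\Lambda}^*(z)=\begin{bmatrix}T_p^*(z)&Q\\0&R^*(z)\end{bmatrix}.$$ Here $T_p^*(z)$ is the $(p+1)\times(p+1)$ upper triangular matrix with diagonal entries $z^{-1}-1$ and entries $-\frac{1}{(k'-k)!}$ at position $(k,k')$, $k<k'$. The matrix $R^*(z)=L_{d,\Lambda}\Delta_\Lambda^*(z)L_{d,\Lambda}^{-1}$ is $2r\times2r$, where $\Delta^*_\Lambda(z)=\mathrm{diag}(z^{-1}-e^{\lambda_1},z^{-1}-e^{-\lambda_1},\dots,z^{-1}-e^{\lambda_r},z^{-1}-e^{-\lambda_r})$ and $L_{d,\Lambda}$ is the (nonsingular) $2r\times 2r$ matrix whose columns are $[\mu^{p+1},\mu^{p+2},\dots,\mu^{d}]^T$ for $\mu=\lambda_1,-\lambda_1,\dots,\lambda_r,-\lambda_r$. Finally $Q=[h_{k,m}]_{k=0,\dots,p;\,m=p+1,\dots,d}$ is the constant (independent of $z$) matrix uniquely determined by $$\mu^ke^{\mu}-\sum_{i=0}^{p-k}\frac{\mu^{k+i}}{i!}+\sum_{m=p+1}^{d}\mu^m h_{k,m}=0,\qquad k=0,\dots,p,\ \mu\in\{\pm\lambda_1,\dots,\pm\lambda_r\}.$$ Equivalently, $H^*_{d,\Lambda}(e^{-\mu})[1,\mu,\dots,\mu^d]^T=0$ for all these $\mu$. *)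

theory Defs
  imports
    "Jordan_Normal_Form.Determinant"
    "HOL-Analysis.Derivative"
    "HOL-Library.Function_Algebras"
    "HOL-Library.Groups_Big_Fun"
begin

hide_const (open) Finite_Cartesian_Product.vec Finite_Cartesian_Product.mat

subsection \<open>Masks, symbols and convolution\<close>

text \<open>The space of finitely supported sequences of \<open>m \<times> m\<close> matrices.\<close>

definition ell00 :: "nat \<Rightarrow> (int \<Rightarrow> 'a::zero mat) set" where
  "ell00 m = {A. (\<forall>\<alpha>. A \<alpha> \<in> carrier_mat m m) \<and> finite {\<alpha>. A \<alpha> \<noteq> 0\<^sub>m m m}}"

text \<open>
  The type of matrices is not an instance of \<^class>\<open>comm_monoid_add\<close>, so sums over all integers
  are taken entrywise. \<^const>\<open>Sum_any\<close> is meaningful whenever the first factor is finitely supported.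
\<close>

definition symbol :: "nat \<Rightarrow> (int \<Rightarrow> 'a::field mat) \<Rightarrow> 'a \<Rightarrow> 'a mat" where
  "symbol m A z = Matrix.mat m m (\<lambda>(i, j). Sum_any (\<lambda>\<alpha>. A \<alpha> $$ (i, j) * z powi \<alpha>))"

definition conv_mat :: "nat \<Rightarrow> (int \<Rightarrow> 'a::semiring_0 mat) \<Rightarrow> (int \<Rightarrow> 'a mat) \<Rightarrow> int \<Rightarrow> 'a mat" where
  "conv_mat m A B \<alpha> = Matrix.mat m m (\<lambda>ij. Sum_any (\<lambda>\<beta>. (A \<beta> * B (\<alpha> - \<beta>)) $$ ij))"

definition conv_vec ::
  "nat \<Rightarrow> (int \<Rightarrow> 'a::semiring_0 mat) \<Rightarrow> (int \<Rightarrow> 'a Matrix.vec) \<Rightarrow> int \<Rightarrow> 'a Matrix.vec" where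
  "conv_vec m A c \<alpha> =
     Matrix.vec m (\<lambda>i. Sum_any (\<lambda>\<beta>. vec_index (A \<beta> *\<^sub>v c (\<alpha> - \<beta>)) i))"

definition complex_mask :: "(int \<Rightarrow> real mat) \<Rightarrow> int \<Rightarrow> complex mat" where
  "complex_mask A = (\<lambda>\<alpha>. map_mat complex_of_real (A \<alpha>))"


subsection \<open>Frequencies and the function space\<close>

definition frequencies :: "nat \<Rightarrow> (nat \<Rightarrow> complex) \<Rightarrow> bool" where
  "frequencies r lam \<longleftrightarrow>
     (\<forall>j\<in>{1..r}. (Im (lam j) = 0 \<or> Re (lam j) = 0) \<and> lam j \<noteq> 0) \<and>
     (\<forall>i\<in>{1..r}. \<forall>j\<in>{1..r}. i \<noteq> j \<longrightarrow> lam i \<noteq> lam j \<and> lam i \<noteq> - lam j)"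

text \<open>
  For \<open>j < 2 * r\<close>, \<open>freq lam j\<close> is the \<open>j\<close>-th element of the list
  \<open>\<lambda>\<^sub>1, -\<lambda>\<^sub>1, \<dots>, \<lambda>\<^sub>r, -\<lambda>\<^sub>r\<close>, counted from \<open>0\<close>.
\<close>

definition freq :: "(nat \<Rightarrow> complex) \<Rightarrow> nat \<Rightarrow> complex" where
  "freq lam j = (if even j then lam (j div 2 + 1) else - lam (j div 2 + 1))"

text \<open>The linear span is taken over the complex numbers, since frequencies may be imaginary.\<close>

definition Vspace :: "nat \<Rightarrow> nat \<Rightarrow> (nat \<Rightarrow> complex) \<Rightarrow> (real \<Rightarrow> complex) set" where
  "Vspace p r lam = Modules.module.span (\<lambda>(c::complex) f x. c * f x)
     ({\<lambda>x. complex_of_real (x ^ k) | k. k \<le> p} \<union>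
      {\<lambda>x. exp (freq lam j * complex_of_real x) | j. j < 2 * r})"

definition nth_derivative :: "nat \<Rightarrow> (real \<Rightarrow> complex) \<Rightarrow> real \<Rightarrow> complex" where
  "nth_derivative k f = ((\<lambda>g x. vector_derivative g (at x)) ^^ k) f"

definition vseq :: "nat \<Rightarrow> (real \<Rightarrow> complex) \<Rightarrow> int \<Rightarrow> complex Matrix.vec" where
  "vseq d f \<alpha> = Matrix.vec (d + 1) (\<lambda>k. nth_derivative k f (real_of_int \<alpha>))"


subsection \<open>The impulse response\<close>

definition Lmat :: "nat \<Rightarrow> nat \<Rightarrow> (nat \<Rightarrow> complex) \<Rightarrow> complex mat" where
  "Lmat p r lam = Matrix.mat (2 * r) (2 * r) (\<lambda>(i, j). freq lam j ^ (p + 1 + i))"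

text \<open>
  The masks below are given by their coefficients: \<open>z\<^sup>-\<^sup>1\<close> in a symbol is the coefficient at \<open>-1\<close>,
  and the constant term is the coefficient at \<open>0\<close>. The symbols are computed in
  \<open>symbol_Tmask\<close>, \<open>symbol_Deltamask\<close>, \<open>symbol_Rmask\<close> and \<open>symbol_Hmask\<close>.
\<close>

definition Tmask :: "nat \<Rightarrow> int \<Rightarrow> complex mat" where
  "Tmask p \<alpha> =
     (if \<alpha> = -1 then 1\<^sub>m (p + 1)
      else if \<alpha> = 0 then Matrix.mat (p + 1) (p + 1)
        (\<lambda>(k, k'). if k = k' then -1 else if k < k' then - 1 / fact (k' - k) else 0)
      else 0\<^sub>m (p + 1) (p + 1))"

definition Deltamask :: "nat \<Rightarrow> (nat \<Rightarrow> complex) \<Rightarrow> int \<Rightarrow> complex mat" where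
  "Deltamask r lam \<alpha> =
     (if \<alpha> = -1 then 1\<^sub>m (2 * r)
      else if \<alpha> = 0 then mat_diag (2 * r) (\<lambda>j. - exp (freq lam j))
      else 0\<^sub>m (2 * r) (2 * r))"

definition Rmask :: "nat \<Rightarrow> nat \<Rightarrow> (nat \<Rightarrow> complex) \<Rightarrow> int \<Rightarrow> complex mat" where
  "Rmask p r lam \<alpha> = Lmat p r lam * Deltamask r lam \<alpha> * the (mat_inverse (Lmat p r lam))"

text \<open>Columns \<open>p + 1, \<dots>, d\<close> of \<open>Q\<close> are stored as columns \<open>0, \<dots>, 2 * r - 1\<close>.\<close>

definition is_Qmat :: "nat \<Rightarrow> nat \<Rightarrow> (nat \<Rightarrow> complex) \<Rightarrow> complex mat \<Rightarrow> bool" where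
  "is_Qmat p r lam Q \<longleftrightarrow> Q \<in> carrier_mat (p + 1) (2 * r) \<and>
     (\<forall>k\<le>p. \<forall>j<2 * r. let \<mu> = freq lam j in
        \<mu> ^ k * exp \<mu> - (\<Sum>i = 0..p - k. \<mu> ^ (k + i) / fact i)
          + (\<Sum>m = p + 1..p + 2 * r. \<mu> ^ m * Q $$ (k, m - (p + 1))) = 0)"

definition Qmat :: "nat \<Rightarrow> nat \<Rightarrow> (nat \<Rightarrow> complex) \<Rightarrow> complex mat" where
  "Qmat p r lam = (THE Q. is_Qmat p r lam Q)"

definition Hmask :: "nat \<Rightarrow> nat \<Rightarrow> (nat \<Rightarrow> complex) \<Rightarrow> int \<Rightarrow> complex mat" where
  "Hmask p r lam \<alpha> =
     four_block_mat (Tmask p \<alpha>) (if \<alpha> = 0 then Qmat p r lam else 0\<^sub>m (p + 1) (2 * r))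
                    (0\<^sub>m (2 * r) (p + 1)) (Rmask p r lam \<alpha>)"


subsection \<open>Well-definedness\<close>

lemma Lmat_carrier [simp]: "Lmat p r lam \<in> carrier_mat (2 * r) (2 * r)"
  by (simp add: Lmat_def)

lemma freq_nonzero: "frequencies r lam \<Longrightarrow> j < 2 * r \<Longrightarrow> freq lam j \<noteq> 0"
  by (auto simp: frequencies_def freq_def)

lemma inj_on_freq:
  assumes "frequencies r lam"
  shows "inj_on (freq lam) {..<2 * r}"
proof (rule inj_onI)
  fix i j assume ij: "i \<in> {..<2 * r}" "j \<in> {..<2 * r}" and eq: "freq lam i = freq lam j"
  define a b where "a = i div 2 + 1" and "b = j div 2 + 1"
  have ab: "a \<in> {1..r}" "b \<in> {1..r}" using ij by (auto simp: a_def b_def)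
  have "lam a = lam b \<or> lam a = - lam b"
    using eq minus_equation_iff[of "lam a" "lam b"]
    by (auto simp: freq_def a_def b_def split: if_splits)
  then have "a = b" using assms ab unfolding frequencies_def by blast
  moreover have "lam b \<noteq> 0" using assms ab unfolding frequencies_def by blast
  moreover have "freq lam i = (if even i then lam a else - lam a)"
    "freq lam j = (if even j then lam b else - lam b)"
    by (simp_all add: freq_def a_def b_def)
  ultimately have "even i = even j"
    using eq by (auto split: if_splits)
  with \<open>a = b\<close> show "i = j"
    unfolding a_def b_def by presburger
qed

lemma det_Lmat:
  assumes fr: "frequencies r lam"
  shows "det (Lmat p r lam) \<noteq> 0"
proof
  let ?L = "Lmat p r lam"
  assume "det ?L = 0"
  then have "det (transpose_mat ?L) = 0" using det_transpose[OF Lmat_carrier] by metis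
  then obtain v where v: "v \<in> carrier_vec (2 * r)" "v \<noteq> 0\<^sub>v (2 * r)"
    and Lv: "transpose_mat ?L *\<^sub>v v = 0\<^sub>v (2 * r)"
    using det_0_iff_vec_prod_zero[of "transpose_mat ?L" "2 * r"] by auto
  define q :: "complex poly" where "q = (\<Sum>i<2 * r. monom (vec_index v i) i)"
  have cq: "coeff q i = (if i < 2 * r then vec_index v i else 0)" for i
    by (simp add: q_def coeff_sum if_distrib cong: if_cong)
  have "q \<noteq> 0"
  proof
    assume "q = 0"
    then have "vec_index v i = 0" if "i < 2 * r" for i using cq[of i] that by simp
    then have "v = 0\<^sub>v (2 * r)" using v(1) by (intro eq_vecI) auto
    with v(2) show False by simp
  qed
  have root: "poly q (freq lam j) = 0" if j: "j < 2 * r" for j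
  proof -
    have "0 = vec_index (transpose_mat ?L *\<^sub>v v) j" using Lv j by simp
    also have "\<dots> = (\<Sum>i<2 * r. freq lam j ^ (p + 1 + i) * vec_index v i)"
      using j v(1) by (simp add: Lmat_def scalar_prod_def lessThan_atLeast0)
    also have "\<dots> = freq lam j ^ (p + 1) * poly q (freq lam j)"
      by (simp add: q_def poly_sum poly_monom sum_distrib_left power_add mult_ac)
    finally show ?thesis using freq_nonzero[OF fr j] by simp
  qed
  have "2 * r = card (freq lam ` {..<2 * r})" using inj_on_freq[OF fr] by (simp add: card_image)
  also have "\<dots> \<le> card {x. poly q x = 0}"
    by (rule card_mono) (use root poly_roots_finite[OF \<open>q \<noteq> 0\<close>] in auto)
  also have "\<dots> \<le> degree q" by (rule card_poly_roots_bound[OF \<open>q \<noteq> 0\<close>])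
  finally have "coeff q (degree q) = 0" by (simp add: cq)
  with \<open>q \<noteq> 0\<close> show False by simp
qed

lemma mat_inverse_Lmat:
  assumes "frequencies r lam"
  shows "Lmat p r lam * the (mat_inverse (Lmat p r lam)) = 1\<^sub>m (2 * r)"
    and "the (mat_inverse (Lmat p r lam)) * Lmat p r lam = 1\<^sub>m (2 * r)"
    and "the (mat_inverse (Lmat p r lam)) \<in> carrier_mat (2 * r) (2 * r)"
proof -
  have "Lmat p r lam \<in> Units (ring_mat TYPE(complex) (2 * r) ())"
    by (rule det_non_zero_imp_unit[OF Lmat_carrier det_Lmat[OF assms]])
  then obtain M where "mat_inverse (Lmat p r lam) = Some M"
    using mat_inverse(1)[OF Lmat_carrier] by fastforce
  with mat_inverse(2)[OF Lmat_carrier this]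
  show "Lmat p r lam * the (mat_inverse (Lmat p r lam)) = 1\<^sub>m (2 * r)"
    and "the (mat_inverse (Lmat p r lam)) * Lmat p r lam = 1\<^sub>m (2 * r)"
    and "the (mat_inverse (Lmat p r lam)) \<in> carrier_mat (2 * r) (2 * r)"
    by auto
qed

lemma is_Qmat_iff:
  "is_Qmat p r lam Q \<longleftrightarrow> Q \<in> carrier_mat (p + 1) (2 * r) \<and>
     Q * Lmat p r lam = Matrix.mat (p + 1) (2 * r)
       (\<lambda>(k, j). (\<Sum>i = 0..p - k. freq lam j ^ (k + i) / fact i) - freq lam j ^ k * exp (freq lam j))"
  (is "_ \<longleftrightarrow> _ \<and> _ = ?W")
proof (cases "Q \<in> carrier_mat (p + 1) (2 * r)")
  case Q: True
  have shift: "(\<Sum>m = p + 1..p + 2 * r. freq lam j ^ m * Q $$ (k, m - (p + 1)))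
                 = (Q * Lmat p r lam) $$ (k, j)" if "k \<le> p" "j < 2 * r" for k j
  proof -
    have "{p + 1..p + 2 * r} = (\<lambda>i. i + (p + 1)) ` {0..<2 * r}"
      unfolding image_add_atLeastLessThan' by auto
    then have "(\<Sum>m = p + 1..p + 2 * r. freq lam j ^ m * Q $$ (k, m - (p + 1)))
        = (\<Sum>i = 0..<2 * r. freq lam j ^ (p + 1 + i) * Q $$ (k, i))"
      by (simp add: sum.reindex inj_on_def add_ac)
    also have "\<dots> = (Q * Lmat p r lam) $$ (k, j)"
      using Q that by (simp add: Lmat_def scalar_prod_def mult_ac)
    finally show ?thesis .
  qed
  have "is_Qmat p r lam Q \<longleftrightarrow>
      (\<forall>k\<le>p. \<forall>j<2 * r. (Q * Lmat p r lam) $$ (k, j) = ?W $$ (k, j))"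
    using Q shift by (auto simp: is_Qmat_def Let_def algebra_simps)
  also have "\<dots> \<longleftrightarrow> Q * Lmat p r lam = ?W"
    using Q by (auto simp: mat_eq_iff Lmat_def less_Suc_eq_le)
  finally show ?thesis using Q by simp
qed (simp add: is_Qmat_def)

lemma ex1_Qmat:
  assumes fr: "frequencies r lam"
  shows "\<exists>!Q. is_Qmat p r lam Q"
proof -
  let ?L = "Lmat p r lam"
  define M where "M = the (mat_inverse ?L)"
  define W where "W = Matrix.mat (p + 1) (2 * r)
       (\<lambda>(k, j). (\<Sum>i = 0..p - k. freq lam j ^ (k + i) / fact i) - freq lam j ^ k * exp (freq lam j))"
  have W: "W \<in> carrier_mat (p + 1) (2 * r)" by (simp add: W_def)
  note M = mat_inverse_Lmat[OF fr, of p, folded M_def]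
  show ?thesis
  proof (rule ex1I[of _ "W * M"])
    have "W * M * ?L = W" using assoc_mult_mat[OF W M(3) Lmat_carrier[of p r lam]] M(2) W by simp
    then show "is_Qmat p r lam (W * M)"
      using W M(3) unfolding is_Qmat_iff W_def[symmetric] by simp
  next
    fix Q assume "is_Qmat p r lam Q"
    then have Q: "Q \<in> carrier_mat (p + 1) (2 * r)" and "Q * ?L = W"
      unfolding is_Qmat_iff W_def[symmetric] by auto
    then have "W * M = Q * (?L * M)" using assoc_mult_mat[OF Q Lmat_carrier[of p r lam] M(3)] by simp
    then show "Q = W * M" using M(1) Q by simp
  qed
qed

lemma is_Qmat_Qmat: "frequencies r lam \<Longrightarrow> is_Qmat p r lam (Qmat p r lam)"
  unfolding Qmat_def by (rule theI') (rule ex1_Qmat)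

lemma Sum_any_two:
  assumes "\<And>\<alpha>. \<alpha> \<noteq> -1 \<Longrightarrow> \<alpha> \<noteq> 0 \<Longrightarrow> g \<alpha> = 0"
  shows "Sum_any g = g (-1) + g (0::int)"
proof -
  have "Sum_any g = sum g {-1, 0}"
    by (rule Sum_any.expand_superset) (use assms in auto)
  then show ?thesis by simp
qed

lemma symbol_Tmask:
  "symbol (p + 1) (Tmask p) z = Matrix.mat (p + 1) (p + 1)
     (\<lambda>(k, k'). if k = k' then inverse z - 1 else if k < k' then - 1 / fact (k' - k) else 0)"
  unfolding symbol_def
  by (rule cong_mat) (auto simp: Tmask_def Sum_any_two power_int_minus)

lemma symbol_Deltamask:
  "symbol (2 * r) (Deltamask r lam) z = mat_diag (2 * r) (\<lambda>j. inverse z - exp (freq lam j))"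
  unfolding symbol_def mat_diag_def
  by (rule cong_mat) (auto simp: Deltamask_def mat_diag_def Sum_any_two power_int_minus)

lemma Rmask_carrier:
  "frequencies r lam \<Longrightarrow> Rmask p r lam \<alpha> \<in> carrier_mat (2 * r) (2 * r)"
  unfolding Rmask_def
  by (intro mult_carrier_mat[OF mult_carrier_mat[OF Lmat_carrier] mat_inverse_Lmat(3)])
     (auto simp: Deltamask_def)

lemma Rmask_eq_0:
  assumes "frequencies r lam" "\<alpha> \<noteq> -1" "\<alpha> \<noteq> 0"
  shows "Rmask p r lam \<alpha> = 0\<^sub>m (2 * r) (2 * r)"
  using assms right_mult_zero_mat[OF Lmat_carrier[of p r lam], of "2 * r"]
    left_mult_zero_mat[OF mat_inverse_Lmat(3)[OF assms(1), of p], of "2 * r"]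
  by (simp add: Rmask_def Deltamask_def)

lemma symbol_Rmask:
  assumes fr: "frequencies r lam"
  shows "symbol (2 * r) (Rmask p r lam) z =
    Lmat p r lam * symbol (2 * r) (Deltamask r lam) z * the (mat_inverse (Lmat p r lam))"
proof -
  let ?L = "Lmat p r lam"
  define M where "M = the (mat_inverse ?L)"
  define n where "n = 2 * r"
  define D0 where "D0 = Deltamask r lam 0"
  note M = mat_inverse_Lmat[OF fr, of p, folded M_def n_def]
  have L: "?L \<in> carrier_mat n n" and D0: "D0 \<in> carrier_mat n n"
    by (auto simp: n_def D0_def Deltamask_def)
  have Dm: "Deltamask r lam (-1) = 1\<^sub>m n" by (simp add: Deltamask_def n_def)
  have Rm: "Rmask p r lam (-1) = 1\<^sub>m n"
    using L M unfolding Rmask_def M_def[symmetric] Dm by simp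
  have R0: "Rmask p r lam 0 = ?L * D0 * M" by (simp add: Rmask_def M_def D0_def)
  have Rz: "Rmask p r lam \<alpha> = 0\<^sub>m n n" if "\<alpha> \<noteq> -1" "\<alpha> \<noteq> 0" for \<alpha>
    unfolding n_def by (rule Rmask_eq_0[OF fr that])
  have sD: "symbol n (Deltamask r lam) z = inverse z \<cdot>\<^sub>m 1\<^sub>m n + D0"
    unfolding n_def symbol_Deltamask D0_def
    by (rule eq_matI) (auto simp: mat_diag_def Deltamask_def)
  have "?L * (inverse z \<cdot>\<^sub>m 1\<^sub>m n + D0) * M = (inverse z \<cdot>\<^sub>m ?L + ?L * D0) * M"
    using L D0 by (simp add: mult_add_distrib_mat[of _ n n _ n] mult_smult_distrib[of _ n n _ n])
  also have "\<dots> = inverse z \<cdot>\<^sub>m 1\<^sub>m n + ?L * D0 * M"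
    using L D0 M by (simp add: add_mult_distrib_mat[of _ n n _ _ n] mult_smult_assoc_mat[of _ n n _ n])
  also have "\<dots> = symbol n (Rmask p r lam) z"
    unfolding symbol_def
  proof (rule eq_matI; clarsimp)
    have LDM: "?L * D0 * M \<in> carrier_mat n n" using L D0 M by simp
    show "dim_row ?L = n" "dim_col M = n" using L M by auto
    fix i j assume ij: "i < n" "j < n"
    have "Sum_any (\<lambda>\<alpha>. Rmask p r lam \<alpha> $$ (i, j) * z powi \<alpha>)
       = Rmask p r lam (-1) $$ (i, j) * z powi (-1) + Rmask p r lam 0 $$ (i, j) * z powi 0"
      by (rule Sum_any_two) (use Rz ij in simp)
    then show "(inverse z \<cdot>\<^sub>m 1\<^sub>m n + ?L * D0 * M) $$ (i, j)
       = Sum_any (\<lambda>\<alpha>. Rmask p r lam \<alpha> $$ (i, j) * z powi \<alpha>)"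
      using ij LDM L M(3) by (auto simp: Rm R0 power_int_minus)
  qed
  finally show ?thesis using sD by (simp add: n_def M_def)
qed

lemma symbol_Hmask:
  assumes fr: "frequencies r lam"
  shows "symbol (p + 2 * r + 1) (Hmask p r lam) z =
    four_block_mat (symbol (p + 1) (Tmask p) z) (Qmat p r lam)
                   (0\<^sub>m (2 * r) (p + 1)) (symbol (2 * r) (Rmask p r lam) z)"
proof -
  have Q: "Qmat p r lam \<in> carrier_mat (p + 1) (2 * r)"
    using is_Qmat_Qmat[OF fr] by (simp add: is_Qmat_def)
  have T: "Tmask p \<alpha> \<in> carrier_mat (p + 1) (p + 1)" for \<alpha> by (simp add: Tmask_def)
  note R = Rmask_carrier[OF fr, of p]
  have dims: "dim_row (Tmask p \<alpha>) = p + 1" "dim_col (Tmask p \<alpha>) = p + 1"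
    "dim_row (Rmask p r lam \<alpha>) = 2 * r" "dim_col (Rmask p r lam \<alpha>) = 2 * r" for \<alpha>
    using T[of \<alpha>] R[of \<alpha>] by auto
  have Qsum: "Sum_any (\<lambda>\<alpha>. (if \<alpha> = 0 then Qmat p r lam else 0\<^sub>m (p + 1) (2 * r)) $$ (i, j) * z powi \<alpha>)
      = Qmat p r lam $$ (i, j)" if "i < p + 1" "j < 2 * r" for i j
    by (subst Sum_any_two) (use that in auto)
  show ?thesis
    by (rule eq_matI) (use Q Qsum in \<open>auto simp: symbol_def Hmask_def dims\<close>)
qed

lemma Hmask_ell00:
  assumes fr: "frequencies r lam"
  shows "Hmask p r lam \<in> ell00 (p + 2 * r + 1)"
proof -
  have Q: "Qmat p r lam \<in> carrier_mat (p + 1) (2 * r)"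
    using is_Qmat_Qmat[OF fr] by (simp add: is_Qmat_def)
  have T: "Tmask p \<alpha> \<in> carrier_mat (p + 1) (p + 1)" for \<alpha> by (simp add: Tmask_def)
  note R = Rmask_carrier[OF fr, of p]
  have c: "Hmask p r lam \<alpha> \<in> carrier_mat (p + 2 * r + 1) (p + 2 * r + 1)" for \<alpha>
    using four_block_carrier_mat[OF T[of \<alpha>] R[of \<alpha>]] by (simp add: Hmask_def add_ac)
  have "Hmask p r lam \<alpha> = 0\<^sub>m (p + 2 * r + 1) (p + 2 * r + 1)" if "\<alpha> \<noteq> -1" "\<alpha> \<noteq> 0" for \<alpha>
  proof -
    have "Rmask p r lam \<alpha> = 0\<^sub>m (2 * r) (2 * r)"
      by (rule Rmask_eq_0[OF fr that])
    then show ?thesis using that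
      by (intro eq_matI) (auto simp: Hmask_def Tmask_def)
  qed
  then have "{\<alpha>. Hmask p r lam \<alpha> \<noteq> 0\<^sub>m (p + 2 * r + 1) (p + 2 * r + 1)} \<subseteq> {-1, 0}" by blast
  then show ?thesis using c finite_subset by (fastforce simp: ell00_def)
qed

end

theory Submission
  imports Defs "HOL-Analysis.Complex_Transcendental"
begin

text \<open>
  The symbol of \<open>H\<close> is \<open>z\<^sup>-\<^sup>1 I - E\<close> with a constant matrix \<open>E\<close>, called \<open>transition\<close> below. So
  \<open>B * H = C\<close> is the first-order recursion \<open>B(\<alpha> + 1) = C(\<alpha>) + B(\<alpha>) E\<close>, which has exactly one
  solution vanishing for all sufficiently negative \<open>\<alpha>\<close>, and Horner's scheme computes it. It remains to
  see that this solution also vanishes for all large \<open>\<alpha>\<close>, and that it is real.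

  \<^item> The matrix \<open>E\<close> shifts samples: \<open>E v\<^sub>f(t) = v\<^sub>f(t + 1)\<close> for the basis functions \<open>f\<close> of the function
  space (\<open>transition_vseq_divided_power\<close>, \<open>transition_vseq_exp\<close>). For the polynomials this is
  Taylor's formula in the block \<open>T\<close>; for the exponentials it is the choice of \<open>Q\<close> and \<open>R\<close>.

  \<^item> Consequently the Horner value \<open>B(\<alpha>)\<close>, applied to a sample vector, is a partial sum of
  \<open>C * v\<^sub>f\<close> (\<open>horner_mult_orbit\<close>). Once the support of \<open>C\<close> is exhausted, the sum is the whole
  convolution, so \<open>B(\<alpha>) v\<^sub>f(0) = 0\<close> for every basis function. The vectors \<open>v\<^sub>f(0)\<close> span the whole space
  because of the invertible Vandermonde-type matrix \<open>L\<close> (\<open>mat_eq_zeroI\<close>), so \<open>B(\<alpha>) = 0\<close>, and the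
  recursion keeps it zero from there on.

  \<^item> The set of frequencies is closed under conjugation, so \<open>E\<close> and its conjugate act in the same
  way on the spanning vectors. Thus \<open>E\<close> is real (\<open>transition_real\<close>), and so is \<open>B\<close>.
\<close>

section \<open>Horner's scheme\<close>

fun horner :: "nat \<Rightarrow> 'a::comm_ring_1 mat \<Rightarrow> (nat \<Rightarrow> 'a mat) \<Rightarrow> nat \<Rightarrow> 'a mat" where
  "horner n E c 0 = 0\<^sub>m n n"
| "horner n E c (Suc k) = c k + horner n E c k * E"

lemma horner_carrier:
  assumes "E \<in> carrier_mat n n" "\<And>k. c k \<in> carrier_mat n n"
  shows "horner n E c k \<in> carrier_mat n n"
  by (induction k) (use assms in auto)

text \<open>
  Along an orbit of \<open>E\<close> each factor \<open>E\<close> in the Horner scheme is absorbed as one step forward in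
  time. The powers of \<open>E\<close> disappear and a partial sum of a convolution remains.
\<close>

lemma horner_mult_orbit:
  assumes E: "E \<in> carrier_mat n n" and c: "\<And>k. c k \<in> carrier_mat n n"
    and w: "\<And>t. w t \<in> carrier_vec n" and shift: "\<And>t::int. E *\<^sub>v w t = w (t + 1)"
    and i: "i < n"
  shows "(horner n E c k *\<^sub>v w (s - int k)) $ i = (\<Sum>l<k. (c l *\<^sub>v w (s - 1 - int l)) $ i)"
proof (induction k)
  case 0
  then show ?case using i w[of s] by simp
next
  case (Suc k)
  let ?w = "w (s - 1 - int k)"
  note G = horner_carrier[of E n c k, OF E c]
  have "horner n E c (Suc k) *\<^sub>v ?w = c k *\<^sub>v ?w + horner n E c k *\<^sub>v (E *\<^sub>v ?w)"
    using G E c[of k] w by (simp add: add_mult_distrib_mat_vec[of _ n n] assoc_mult_mat_vec[of _ n n _ n])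
  also have "E *\<^sub>v ?w = w (s - int k)" by (simp add: shift)
  finally have "(horner n E c (Suc k) *\<^sub>v ?w) $ i =
      (c k *\<^sub>v ?w) $ i + (horner n E c k *\<^sub>v w (s - int k)) $ i"
    using i G c[of k] by simp
  moreover have "s - int (Suc k) = s - 1 - int k" by simp
  ultimately show ?case using Suc.IH by (simp only: sum.lessThan_Suc add.commute)
qed

lemma horner_eventually_zero:
  assumes E: "E \<in> carrier_mat n n" and z: "horner n E c K = 0\<^sub>m n n"
    and c: "\<And>k. k \<ge> K \<Longrightarrow> c k = 0\<^sub>m n n" and k: "k \<ge> K"
  shows "horner n E c k = 0\<^sub>m n n"
  using k by (induction rule: dec_induct) (use E z c in auto)

lemma map_mat_horner:
  assumes "E \<in> carrier_mat n n" "\<And>k. c k \<in> carrier_mat n n"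
  shows "map_mat complex_of_real (horner n E c k) =
    horner n (map_mat complex_of_real E) (\<lambda>k. map_mat complex_of_real (c k)) k"
proof (induction k)
  case 0
  show ?case by (rule eq_matI) auto
next
  case (Suc k)
  note G = horner_carrier[of E n c k, OF assms]
  have "map_mat complex_of_real (c k + horner n E c k * E)
      = map_mat complex_of_real (c k) + map_mat complex_of_real (horner n E c k * E)"
    by (rule eq_matI) (use G assms(1) assms(2)[of k] in auto)
  also have "map_mat complex_of_real (horner n E c k * E)
      = map_mat complex_of_real (horner n E c k) * map_mat complex_of_real E"
    by (rule of_real_hom.mat_hom_mult[OF G assms(1)])
  finally show ?case by (simp add: Suc.IH)
qed

section \<open>The sampled basis functions\<close>

lemma nth_derivative_Suc:
  "nth_derivative (Suc k) f x = vector_derivative (nth_derivative k f) (at x)"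
  by (simp add: nth_derivative_def)

lemma nth_derivative_exp:
  "nth_derivative k (\<lambda>x. exp (\<mu> * complex_of_real x)) = (\<lambda>x. \<mu> ^ k * exp (\<mu> * complex_of_real x))"
proof (induction k)
  case 0
  show ?case by (simp add: nth_derivative_def)
next
  case (Suc k)
  have "((\<lambda>x. \<mu> ^ k * exp (\<mu> * complex_of_real x)) has_vector_derivative
      \<mu> ^ Suc k * exp (\<mu> * complex_of_real x)) (at x)" for x
    by (rule has_vector_derivative_real_field) (auto intro!: derivative_eq_intros)
  then show ?case
    by (intro ext) (simp only: nth_derivative_Suc Suc.IH vector_derivative_at)
qed

text \<open>
  Dividing by the factorial makes differentiation lower the index by one, and makes the samples at
  \<open>0\<close> unit vectors.
\<close>

definition divided_power :: "nat \<Rightarrow> real \<Rightarrow> complex" where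
  "divided_power m x = complex_of_real x ^ m / fact m"

lemma nth_derivative_divided_power:
  "nth_derivative k (divided_power m) = (\<lambda>x. if k \<le> m then divided_power (m - k) x else 0)"
proof (induction k)
  case 0
  show ?case by (simp add: nth_derivative_def)
next
  case (Suc k)
  have "((\<lambda>x. if k \<le> m then divided_power (m - k) x else 0) has_vector_derivative
      (if Suc k \<le> m then divided_power (m - Suc k) x else 0)) (at x)" for x
  proof (cases "Suc k \<le> m")
    case True
    then obtain l where l: "m - k = Suc l" "m - Suc k = l" by (metis Suc_diff_Suc Suc_le_lessD)
    have "((\<lambda>z::complex. z ^ Suc l / fact (Suc l)) has_field_derivative z ^ l / fact l) (at z)" for z
    proof -
      have "((\<lambda>z::complex. z ^ Suc l / fact (Suc l)) has_field_derivative
          (of_nat (Suc l) * z ^ l) / fact (Suc l)) (at z)"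
        using DERIV_cdivide[OF DERIV_power[where n = "Suc l", OF DERIV_ident], of "fact (Suc l)"]
        by (simp del: of_nat_Suc power_Suc fact_Suc)
      moreover have "(of_nat (Suc l) * z ^ l) / fact (Suc l) = z ^ l / fact l"
        using of_nat_neq_0[where 'a = complex, of l] by (simp add: field_simps del: of_nat_Suc)
      ultimately show ?thesis by simp
    qed
    from has_vector_derivative_real_field[OF this] show ?thesis
      using True l by (simp add: divided_power_def[abs_def])
  next
    case False
    then show ?thesis by (cases "k = m") (auto simp: divided_power_def[abs_def])
  qed
  then show ?case
    by (intro ext) (simp only: nth_derivative_Suc Suc.IH vector_derivative_at)
qed

lemma module_functions: "Modules.module (\<lambda>(c::complex) (f::real \<Rightarrow> complex) x. c * f x)"
  by unfold_locales (auto simp: fun_eq_iff algebra_simps)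

lemma exp_in_Vspace: "j < 2 * r \<Longrightarrow> (\<lambda>x. exp (freq lam j * complex_of_real x)) \<in> Vspace p r lam"
  unfolding Vspace_def by (rule Modules.module.span_base[OF module_functions]) blast

lemma divided_power_in_Vspace:
  assumes "m \<le> p"
  shows "divided_power m \<in> Vspace p r lam"
proof -
  have "(\<lambda>x. (1 / fact m) * complex_of_real (x ^ m)) \<in> Vspace p r lam"
    unfolding Vspace_def
    by (rule Modules.module.span_scale[OF module_functions], rule module.span_base[OF module_functions])
       (use assms in blast)
  then show ?thesis by (simp add: divided_power_def[abs_def])
qed

text \<open>
  The binomial theorem, read as Taylor's formula for the derivative of order \<open>k\<close>.
\<close>

lemma divided_power_add_one:
  assumes "k \<le> m"
  shows "(\<Sum>l = k..m. divided_power (m - l) x / fact (l - k)) = divided_power (m - k) (x + 1)"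
proof -
  have "(\<Sum>l = k..m. divided_power (m - l) x / fact (l - k))
      = (\<Sum>i\<le>m - k. divided_power (m - k - i) x / fact i)"
    by (rule sum.reindex_bij_witness[of _ "\<lambda>i. i + k" "\<lambda>l. l - k"]) (use assms in auto)
  also have "\<dots> = (\<Sum>i\<le>m - k. of_nat ((m - k) choose i) * complex_of_real x ^ (m - k - i) / fact (m - k))"
    by (rule sum.cong) (auto simp: divided_power_def binomial_fact field_simps)
  also have "\<dots> = (1 + complex_of_real x) ^ (m - k) / fact (m - k)"
    by (subst binomial_ring) (simp add: sum_divide_distrib)
  finally show ?thesis by (simp add: divided_power_def add.commute)
qed

section \<open>The transition matrix\<close>

text \<open>
  The coefficient of the impulse response at \<open>-1\<close> is the identity (\<open>Hmask_minus_one\<close>), so the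
  negated coefficient at \<open>0\<close> is the matrix of the first-order recursion that \<open>H\<close> stands for.
\<close>

definition transition :: "nat \<Rightarrow> nat \<Rightarrow> (nat \<Rightarrow> complex) \<Rightarrow> complex mat" where
  "transition p r lam = - Hmask p r lam 0"

context
  fixes p r :: nat and lam :: "nat \<Rightarrow> complex"
  assumes fr: "frequencies r lam"
begin

private abbreviation (input) "n \<equiv> p + 2 * r + 1"
private abbreviation (input) "E \<equiv> transition p r lam"

lemma Hmask_carrier: "Hmask p r lam \<alpha> \<in> carrier_mat n n"
  using Hmask_ell00[OF fr] by (auto simp: ell00_def)

lemma transition_carrier: "E \<in> carrier_mat n n"
  using Hmask_carrier[of 0] by (simp add: transition_def)

lemma Qmat_carrier: "Qmat p r lam \<in> carrier_mat (p + 1) (2 * r)"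
  using is_Qmat_Qmat[OF fr] by (simp add: is_Qmat_def)

lemma Hmask_dims:
  "dim_row (Tmask p \<alpha>) = p + 1" "dim_col (Tmask p \<alpha>) = p + 1"
  "dim_row (Rmask p r lam \<alpha>) = 2 * r" "dim_col (Rmask p r lam \<alpha>) = 2 * r"
  using Rmask_carrier[OF fr, of p \<alpha>] by (auto simp: Tmask_def)

lemma transition_upper_left:
  "i \<le> p \<Longrightarrow> k \<le> p \<Longrightarrow> E $$ (i, k) = (if i \<le> k then 1 / fact (k - i) else 0)"
  using Hmask_carrier[of 0] Qmat_carrier
  by (auto simp: transition_def Hmask_def Hmask_dims) (auto simp: Tmask_def)

lemma transition_upper_right:
  "i \<le> p \<Longrightarrow> k < 2 * r \<Longrightarrow> E $$ (i, p + 1 + k) = - Qmat p r lam $$ (i, k)"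
  using Hmask_carrier[of 0] Qmat_carrier
  by (auto simp: transition_def Hmask_def Hmask_dims)

lemma transition_lower_left:
  "i < 2 * r \<Longrightarrow> k \<le> p \<Longrightarrow> E $$ (p + 1 + i, k) = 0"
  using Hmask_carrier[of 0] Qmat_carrier
  by (auto simp: transition_def Hmask_def Hmask_dims)

lemma transition_lower_right:
  "i < 2 * r \<Longrightarrow> k < 2 * r \<Longrightarrow> E $$ (p + 1 + i, p + 1 + k) = - Rmask p r lam 0 $$ (i, k)"
  using Hmask_carrier[of 0] Qmat_carrier
  by (auto simp: transition_def Hmask_def Hmask_dims)

lemma Hmask_minus_one: "Hmask p r lam (-1) = 1\<^sub>m n"
proof -
  have "Rmask p r lam (-1) = 1\<^sub>m (2 * r)"
    by (simp add: Rmask_def Deltamask_def right_mult_one_mat[OF Lmat_carrier] mat_inverse_Lmat(1)[OF fr])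
  then show ?thesis
    by (intro eq_matI) (auto simp: Hmask_def Tmask_def)
qed

lemma Hmask_outside: "\<alpha> \<noteq> -1 \<Longrightarrow> \<alpha> \<noteq> 0 \<Longrightarrow> Hmask p r lam \<alpha> = 0\<^sub>m n n"
  using Rmask_eq_0[OF fr] by (intro eq_matI) (auto simp: Hmask_def Tmask_def)

lemma lower_indexE:
  assumes "i < n" "\<not> i \<le> p"
  obtains i' where "i = p + 1 + i'" "i' < 2 * r"
  using that[of "i - (p + 1)"] assms by simp

lemma sum_split_blocks:
  fixes g :: "nat \<Rightarrow> 'a::comm_monoid_add"
  shows "(\<Sum>k<n. g k) = (\<Sum>k\<le>p. g k) + (\<Sum>k<2 * r. g (p + 1 + k))"
proof -
  have "(\<Sum>k<m. g k) + (\<Sum>k<q. g (m + k)) = (\<Sum>k<m + q. g k)" for m q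
    by (induction q) (simp_all flip: add.assoc)
  from this[of "Suc p" "2 * r"] show ?thesis by (simp add: lessThan_Suc_atMost)
qed

text \<open>
  The columns of \<open>L\<close> are eigenvectors of \<open>R(0) = L \<Delta>(0) L\<^sup>-\<^sup>1\<close>.
\<close>

lemma Rmask_mult_freq_powers:
  assumes "j < 2 * r" "i < 2 * r"
  shows "(\<Sum>k<2 * r. Rmask p r lam 0 $$ (i, k) * freq lam j ^ (p + 1 + k))
    = - exp (freq lam j) * freq lam j ^ (p + 1 + i)"
proof -
  let ?L = "Lmat p r lam" and ?D = "Deltamask r lam 0"
  let ?M = "the (mat_inverse ?L)"
  note L = Lmat_carrier[of p r lam] and M = mat_inverse_Lmat[OF fr, of p]
  have D: "?D \<in> carrier_mat (2 * r) (2 * r)" by (simp add: Deltamask_def)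
  have "Rmask p r lam 0 * ?L = ?L * ?D * (?M * ?L)"
    unfolding Rmask_def by (rule assoc_mult_mat[OF mult_carrier_mat[OF L D] M(3) L])
  also have "\<dots> = ?L * ?D" unfolding M(2) by (rule right_mult_one_mat[OF mult_carrier_mat[OF L D]])
  finally have eq: "Rmask p r lam 0 * ?L = ?L * ?D" .
  have "(\<Sum>k<2 * r. Rmask p r lam 0 $$ (i, k) * freq lam j ^ (p + 1 + k))
      = (Rmask p r lam 0 * ?L) $$ (i, j)"
    using assms Rmask_carrier[OF fr, of p 0]
    by (simp add: Lmat_def scalar_prod_def lessThan_atLeast0)
  also have "\<dots> = - exp (freq lam j) * freq lam j ^ (p + 1 + i)"
    unfolding eq using assms
    by (simp add: Deltamask_def mat_diag_mult_right[OF L]) (simp add: Lmat_def)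
  finally show ?thesis .
qed

text \<open>
  \<open>[1, \<mu>, \<dots>, \<mu>\<^sup>d]\<close> is an eigenvector of \<open>E\<close> for the eigenvalue \<open>e\<^sup>\<mu>\<close>: in the upper rows this is
  the defining equation of \<open>Q\<close>, in the lower rows the diagonalization of \<open>R\<close>.
\<close>

lemma transition_freq_powers:
  assumes j: "j < 2 * r" and i: "i < n"
  shows "(\<Sum>k<n. E $$ (i, k) * freq lam j ^ k) = exp (freq lam j) * freq lam j ^ i"
proof (cases "i \<le> p")
  case True
  let ?\<mu> = "freq lam j"
  have "(\<Sum>k\<le>p. E $$ (i, k) * ?\<mu> ^ k) = (\<Sum>k=i..p. ?\<mu> ^ k / fact (k - i))"
    using True transition_upper_left by (intro sum.mono_neutral_cong_right) auto
  also have "\<dots> = (\<Sum>l = 0..p - i. ?\<mu> ^ (i + l) / fact l)"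
    by (rule sum.reindex_bij_witness[of _ "\<lambda>l. l + i" "\<lambda>k. k - i"]) (use True in auto)
  finally have 1: "(\<Sum>k\<le>p. E $$ (i, k) * ?\<mu> ^ k) = (\<Sum>l = 0..p - i. ?\<mu> ^ (i + l) / fact l)" .
  have 2: "(\<Sum>k<2 * r. E $$ (i, p + 1 + k) * ?\<mu> ^ (p + 1 + k))
      = - (\<Sum>m = p + 1..p + 2 * r. ?\<mu> ^ m * Qmat p r lam $$ (i, m - (p + 1)))"
    unfolding sum_negf[symmetric]
    by (rule sum.reindex_bij_witness[of _ "\<lambda>m. m - (p + 1)" "\<lambda>k. p + 1 + k"])
       (use True transition_upper_right in \<open>auto simp: mult.commute\<close>)
  have "?\<mu> ^ i * exp ?\<mu> - (\<Sum>l = 0..p - i. ?\<mu> ^ (i + l) / fact l)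
      + (\<Sum>m = p + 1..p + 2 * r. ?\<mu> ^ m * Qmat p r lam $$ (i, m - (p + 1))) = 0"
    using is_Qmat_Qmat[OF fr, of p] True j unfolding is_Qmat_def Let_def by blast
  then show ?thesis
    unfolding sum_split_blocks 1 2 by (simp add: algebra_simps)
next
  case False
  then obtain i' where i': "i = p + 1 + i'" "i' < 2 * r"
    by (rule lower_indexE[OF i])
  show ?thesis
    using Rmask_mult_freq_powers[OF j i'(2)] i'
    by (simp only: sum_split_blocks)
       (simp add: transition_lower_left[simplified] transition_lower_right[simplified] sum_negf)
qed

lemma mult_mat_vec_nth:
  assumes "M \<in> carrier_mat n n" "w \<in> carrier_vec n" "i < n"
  shows "(M *\<^sub>v w) $ i = (\<Sum>k<n. M $$ (i, k) * w $ k)"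
  using assms by (simp add: scalar_prod_def lessThan_atLeast0)

lemma transition_vseq_exp:
  assumes "j < 2 * r"
  shows "E *\<^sub>v vseq (p + 2 * r) (\<lambda>x. exp (freq lam j * complex_of_real x)) t
    = vseq (p + 2 * r) (\<lambda>x. exp (freq lam j * complex_of_real x)) (t + 1)"
proof (rule eq_vecI)
  let ?v = "vseq (p + 2 * r) (\<lambda>x. exp (freq lam j * complex_of_real x))"
  fix i assume "i < dim_vec (?v (t + 1))"
  then have i: "i < n" by (simp add: vseq_def)
  have "(E *\<^sub>v ?v t) $ i = (\<Sum>k<n. E $$ (i, k) * (freq lam j ^ k * exp (freq lam j * of_int t)))"
    by (subst mult_mat_vec_nth[OF transition_carrier _ i])
       (auto simp: vseq_def nth_derivative_exp)
  also have "\<dots> = (\<Sum>k<n. E $$ (i, k) * freq lam j ^ k) * exp (freq lam j * of_int t)"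
    by (simp add: sum_distrib_right mult.assoc del: sum.lessThan_Suc)
  also have "\<dots> = ?v (t + 1) $ i"
    unfolding transition_freq_powers[OF assms i]
    using i by (simp add: vseq_def nth_derivative_exp distrib_left exp_add)
  finally show "(E *\<^sub>v ?v t) $ i = ?v (t + 1) $ i" .
qed (use transition_carrier in \<open>auto simp: vseq_def\<close>)

lemma transition_vseq_divided_power:
  assumes m: "m \<le> p"
  shows "E *\<^sub>v vseq (p + 2 * r) (divided_power m) t = vseq (p + 2 * r) (divided_power m) (t + 1)"
proof (rule eq_vecI)
  let ?v = "vseq (p + 2 * r) (divided_power m)"
  fix i assume "i < dim_vec (?v (t + 1))"
  then have i: "i < n" by (simp add: vseq_def)
  have "(E *\<^sub>v ?v t) $ i
      = (\<Sum>k<n. E $$ (i, k) * (if k \<le> m then divided_power (m - k) (of_int t) else 0))"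
    by (subst mult_mat_vec_nth[OF transition_carrier _ i])
       (auto simp: vseq_def nth_derivative_divided_power)
  also have "\<dots> = (\<Sum>k\<le>m. E $$ (i, k) * divided_power (m - k) (of_int t))"
    using m by (intro sum.mono_neutral_cong_right) auto
  also have "\<dots> = (if i \<le> m then divided_power (m - i) (of_int t + 1) else 0)"
  proof (cases "i \<le> p")
    case True
    have "(\<Sum>k\<le>m. E $$ (i, k) * divided_power (m - k) (of_int t))
        = (\<Sum>k=i..m. divided_power (m - k) (of_int t) / fact (k - i))"
      using True m transition_upper_left by (intro sum.mono_neutral_cong_right) auto
    then show ?thesis using divided_power_add_one by simp
  next
    case False
    then obtain i' where "i = p + 1 + i'" "i' < 2 * r"
      by (rule lower_indexE[OF i])
    then show ?thesis using m transition_lower_left[of i'] by simp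
  qed
  also have "\<dots> = ?v (t + 1) $ i"
    using i by (simp add: vseq_def nth_derivative_divided_power)
  finally show "(E *\<^sub>v ?v t) $ i = ?v (t + 1) $ i" .
qed (use transition_carrier in \<open>auto simp: vseq_def\<close>)

section \<open>Unisolvence\<close>

text \<open>
  A matrix is determined by its action on the first \<open>p + 1\<close> unit vectors and on the vectors
  \<open>[1, \<mu>, \<dots>, \<mu>\<^sup>d]\<close>. If both vanish, the columns from \<open>p + 1\<close> on form a matrix \<open>N\<close>
  with \<open>N L = 0\<close>, and \<open>L\<close> is invertible. The lemma is used twice, for the reality of \<open>E\<close> and for the vanishing
  of the last Horner value.
\<close>

lemma mat_eq_zeroI:
  assumes M: "M \<in> carrier_mat n n"
    and cols: "\<And>i k. i < n \<Longrightarrow> k \<le> p \<Longrightarrow> M $$ (i, k) = 0"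
    and pows: "\<And>i j. i < n \<Longrightarrow> j < 2 * r \<Longrightarrow> (\<Sum>k<n. M $$ (i, k) * freq lam j ^ k) = 0"
  shows "M = 0\<^sub>m n n"
proof -
  let ?L = "Lmat p r lam"
  let ?I = "the (mat_inverse ?L)"
  define N where "N = Matrix.mat n (2 * r) (\<lambda>(i, k). M $$ (i, p + 1 + k))"
  have N: "N \<in> carrier_mat n (2 * r)" by (simp add: N_def)
  note L = Lmat_carrier[of p r lam] and inv = mat_inverse_Lmat[OF fr, of p]
  have NL: "N * ?L = 0\<^sub>m n (2 * r)"
  proof (rule eq_matI)
    fix i j assume "i < dim_row (0\<^sub>m n (2 * r))" "j < dim_col (0\<^sub>m n (2 * r))"
    then have ij: "i < n" "j < 2 * r" by auto
    have "(N * ?L) $$ (i, j) = (\<Sum>k<2 * r. M $$ (i, p + 1 + k) * freq lam j ^ (p + 1 + k))"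
      using ij by (simp add: scalar_prod_def lessThan_atLeast0 N_def Lmat_def)
    also have "\<dots> = 0" using pows[OF ij] cols[OF ij(1)] by (simp only: sum_split_blocks) simp
    finally show "(N * ?L) $$ (i, j) = 0\<^sub>m n (2 * r) $$ (i, j)" using ij by simp
  qed (use carrier_matD[OF N] carrier_matD[OF L] in simp_all)
  have "N = N * ?L * ?I" using assoc_mult_mat[OF N L inv(3)] inv(1) N by simp
  also have "\<dots> = 0\<^sub>m n (2 * r)" using NL inv(3) by simp
  finally have N0: "N = 0\<^sub>m n (2 * r)" .
  show ?thesis
  proof (rule eq_matI)
    fix i k assume "i < dim_row (0\<^sub>m n n)" "k < dim_col (0\<^sub>m n n)"
    then have ik: "i < n" "k < n" by auto
    show "M $$ (i, k) = 0\<^sub>m n n $$ (i, k)"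
    proof (cases "k \<le> p")
      case False
      then obtain k' where k': "k = p + 1 + k'" "k' < 2 * r"
        by (rule lower_indexE[OF ik(2)])
      then have "M $$ (i, k) = N $$ (i, k')" using ik by (simp add: N_def)
      then show ?thesis using N0 ik k' by simp
    qed (use cols ik in simp)
  qed (use M in auto)
qed

text \<open>
  Conjugation fixes a real frequency and negates an imaginary one, which swaps the two neighbours
  \<open>\<lambda>\<close> and \<open>-\<lambda>\<close> in the list of frequencies.
\<close>

lemma cnj_freq:
  assumes "j < 2 * r"
  obtains j' where "j' < 2 * r" "freq lam j' = cnj (freq lam j)"
proof -
  let ?l = "lam (j div 2 + 1)"
  have "Im ?l = 0 \<or> Re ?l = 0"
    using fr assms unfolding frequencies_def by auto
  then show thesis
  proof
    assume "Im ?l = 0"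
    then have "cnj (freq lam j) = freq lam j" by (simp add: freq_def complex_eq_iff)
    with assms that show ?thesis by metis
  next
    assume "Re ?l = 0"
    then have "cnj (freq lam j) = - freq lam j" by (simp add: freq_def complex_eq_iff)
    moreover define j' where "j' = (if even j then j + 1 else j - 1)"
    have "freq lam j' = - freq lam j" by (auto simp: j'_def freq_def elim!: oddE)
    moreover have "j' < 2 * r" using assms by (auto simp: j'_def elim!: evenE)
    ultimately show ?thesis using that by metis
  qed
qed

text \<open>
  Conjugating the eigenvector equations of \<open>E\<close> permutes them, so the difference between \<open>E\<close> and its
  conjugate kills all eigenvectors \<open>[1, \<mu>, \<dots>, \<mu>\<^sup>d]\<close>. Its first \<open>p + 1\<close> columns vanish because those
  of \<open>E\<close> consist of inverse factorials and zeros.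
\<close>

lemma transition_real: "map_mat complex_of_real (map_mat Re E) = E"
proof -
  define M where "M = map_mat (\<lambda>z. z - cnj z) E"
  have "M = 0\<^sub>m n n"
  proof (rule mat_eq_zeroI)
    show "M \<in> carrier_mat n n" using transition_carrier by (simp add: M_def)
  next
    fix i k assume ik: "i < n" "k \<le> p"
    have "E $$ (i, k) = cnj (E $$ (i, k))"
    proof (cases "i \<le> p")
      case False
      then obtain i' where "i = p + 1 + i'" "i' < 2 * r"
        by (rule lower_indexE[OF ik(1)])
      then show ?thesis using ik transition_lower_left by simp
    qed (use ik transition_upper_left in simp)
    then show "M $$ (i, k) = 0" using ik transition_carrier by (simp add: M_def)
  next
    fix i j assume i: "i < n" and j: "j < 2 * r"
    obtain j' where j': "j' < 2 * r" "freq lam j' = cnj (freq lam j)" using cnj_freq[OF j] .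
    have "(\<Sum>k<n. cnj (E $$ (i, k)) * freq lam j ^ k) = cnj (\<Sum>k<n. E $$ (i, k) * freq lam j' ^ k)"
      using j' by simp
    also have "\<dots> = exp (freq lam j) * freq lam j ^ i"
      unfolding transition_freq_powers[OF j'(1) i] using j' by (simp flip: exp_cnj)
    also have "\<dots> = (\<Sum>k<n. E $$ (i, k) * freq lam j ^ k)"
      by (rule transition_freq_powers[OF j i, symmetric])
    finally show "(\<Sum>k<n. M $$ (i, k) * freq lam j ^ k) = 0"
      using i transition_carrier by (simp add: M_def left_diff_distrib sum_subtractf)
  qed
  then have "M $$ (i, k) = 0" if "i < n" "k < n" for i k using that by simp
  then have "cnj (E $$ (i, k)) = E $$ (i, k)" if "i < n" "k < n" for i k
    using that transition_carrier by (force simp: M_def)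
  then show ?thesis
    using transition_carrier
    by (intro eq_matI) (auto simp: complex_eq_iff)
qed

section \<open>Factorization\<close>

text \<open>
  Only the coefficients of \<open>H\<close> at \<open>-1\<close> and at \<open>0\<close> contribute to the convolution.
\<close>

lemma conv_mat_Hmask:
  assumes B: "\<And>\<alpha>. B \<alpha> \<in> carrier_mat n n"
  shows "conv_mat n B (Hmask p r lam) \<alpha> = B (\<alpha> + 1) - B \<alpha> * E"
proof (rule eq_matI)
  fix i j assume "i < dim_row (B (\<alpha> + 1) - B \<alpha> * E)" "j < dim_col (B (\<alpha> + 1) - B \<alpha> * E)"
  then have ij: "i < n" "j < n"
    using B[of \<alpha>] B[of "\<alpha> + 1"] transition_carrier by auto
  have "Sum_any (\<lambda>\<beta>. (B \<beta> * Hmask p r lam (\<alpha> - \<beta>)) $$ (i, j))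
      = (\<Sum>\<beta>\<in>{\<alpha> + 1, \<alpha>}. (B \<beta> * Hmask p r lam (\<alpha> - \<beta>)) $$ (i, j))"
  proof (rule Sum_any.expand_superset)
    show "{\<beta>. (B \<beta> * Hmask p r lam (\<alpha> - \<beta>)) $$ (i, j) \<noteq> 0} \<subseteq> {\<alpha> + 1, \<alpha>}"
    proof (rule subsetI, rule ccontr)
      fix \<beta> assume "\<beta> \<in> {\<beta>. (B \<beta> * Hmask p r lam (\<alpha> - \<beta>)) $$ (i, j) \<noteq> 0}" "\<beta> \<notin> {\<alpha> + 1, \<alpha>}"
      then show False using Hmask_outside[of "\<alpha> - \<beta>"] right_mult_zero_mat[OF B, of \<beta>] ij by auto
    qed
  qed simp
  also have "\<dots> = (B (\<alpha> + 1) - B \<alpha> * E) $$ (i, j)"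
    using ij B[of "\<alpha> + 1"] B[of \<alpha>] Hmask_carrier[of 0]
    by (simp add: Hmask_minus_one transition_def)
  finally show "conv_mat n B (Hmask p r lam) \<alpha> $$ (i, j) = (B (\<alpha> + 1) - B \<alpha> * E) $$ (i, j)"
    using ij by (simp add: conv_mat_def)
qed (use B[of \<alpha>] B[of "\<alpha> + 1"] transition_carrier in \<open>auto simp: conv_mat_def\<close>)

text \<open>
  With \<open>C\<close> supported in \<open>{-N..<K - N}\<close>, all \<open>K\<close> coefficients have been consumed after \<open>K\<close> Horner
  steps, so the partial sum is the full convolution. The time at which it is evaluated is chosen so that
  the Horner value acts on \<open>w(0)\<close>.
\<close>

lemma horner_annihilates_orbit:
  assumes C: "\<And>\<beta>. C \<beta> \<in> carrier_mat n n"
    and supp: "\<And>\<beta>. C \<beta> \<noteq> 0\<^sub>m n n \<Longrightarrow> - N \<le> \<beta> \<and> \<beta> < int K - N"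
    and w: "\<And>t. w t \<in> carrier_vec n" and shift: "\<And>t::int. E *\<^sub>v w t = w (t + 1)"
    and conv: "conv_vec n C w = (\<lambda>\<alpha>. 0\<^sub>v n)"
  shows "horner n E (\<lambda>l. C (int l - N)) K *\<^sub>v w 0 = 0\<^sub>v n"
proof (rule eq_vecI)
  let ?G = "horner n E (\<lambda>l. C (int l - N)) K"
  let ?\<alpha> = "int K - 1 - N"
  fix i assume "i < dim_vec (0\<^sub>v n :: complex Matrix.vec)"
  then have i: "i < n" by simp
  have "(?G *\<^sub>v w (int K - int K)) $ i = (\<Sum>l<K. (C (int l - N) *\<^sub>v w (int K - 1 - int l)) $ i)"
    by (rule horner_mult_orbit[where c = "\<lambda>l. C (int l - N)" and w = w, OF transition_carrier C w shift i])
  also have "\<dots> = (\<Sum>\<beta>\<in>{- N..<int K - N}. (C \<beta> *\<^sub>v w (?\<alpha> - \<beta>)) $ i)"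
    by (rule sum.reindex_bij_witness[of _ "\<lambda>\<beta>. nat (\<beta> + N)" "\<lambda>l. int l - N"]) (auto simp: algebra_simps)
  also have "\<dots> = Sum_any (\<lambda>\<beta>. (C \<beta> *\<^sub>v w (?\<alpha> - \<beta>)) $ i)"
  proof (rule Sum_any.expand_superset[symmetric])
    show "{\<beta>. (C \<beta> *\<^sub>v w (?\<alpha> - \<beta>)) $ i \<noteq> 0} \<subseteq> {- N..<int K - N}"
    proof
      fix \<beta> assume "\<beta> \<in> {\<beta>. (C \<beta> *\<^sub>v w (?\<alpha> - \<beta>)) $ i \<noteq> 0}"
      then have "C \<beta> \<noteq> 0\<^sub>m n n" using w[of "?\<alpha> - \<beta>"] i by auto
      then show "\<beta> \<in> {- N..<int K - N}" using supp by auto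
    qed
  qed simp
  also have "\<dots> = conv_vec n C w ?\<alpha> $ i" using i by (simp add: conv_vec_def)
  finally show "(?G *\<^sub>v w 0) $ i = 0\<^sub>v n $ i" by (simp only: conv diff_self)
next
  show "dim_vec (horner n E (\<lambda>l. C (int l - N)) K *\<^sub>v w 0) = dim_vec (0\<^sub>v n :: complex Matrix.vec)"
    using horner_carrier[where c = "\<lambda>l. C (int l - N)" and k = K, OF transition_carrier C] by simp
qed

lemma horner_remainder_zero:
  assumes C: "\<And>\<beta>. C \<beta> \<in> carrier_mat n n"
    and supp: "\<And>\<beta>. C \<beta> \<noteq> 0\<^sub>m n n \<Longrightarrow> - N \<le> \<beta> \<and> \<beta> < int K - N"
    and ann: "\<forall>f\<in>Vspace p r lam. conv_vec n C (vseq (p + 2 * r) f) = (\<lambda>\<alpha>. 0\<^sub>v n)"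
  shows "horner n E (\<lambda>l. C (int l - N)) K = 0\<^sub>m n n"
proof (rule mat_eq_zeroI)
  let ?G = "horner n E (\<lambda>l. C (int l - N)) K"
  show G: "?G \<in> carrier_mat n n" by (rule horner_carrier[where c = "\<lambda>l. C (int l - N)", OF transition_carrier C])
  have v: "vseq (p + 2 * r) f t \<in> carrier_vec n" for f t by (simp add: vseq_def)
  fix i assume i: "i < n"
  {
    fix k assume k: "k \<le> p"
    \<comment> \<open>The sample at 0 is the \<open>k\<close>-th unit vector.\<close>
    let ?w = "vseq (p + 2 * r) (divided_power k)"
    have "0 = (?G *\<^sub>v ?w 0) $ i"
      using horner_annihilates_orbit[where C = C and w = ?w, OF C supp v transition_vseq_divided_power[OF k]]
        ann divided_power_in_Vspace[OF k] i by simp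
    also have "\<dots> = (\<Sum>l<n. ?G $$ (i, l) * ?w 0 $ l)" by (rule mult_mat_vec_nth[OF G v i])
    also have "\<dots> = (\<Sum>l<n. if l = k then ?G $$ (i, k) else 0)"
      by (rule sum.cong) (auto simp: vseq_def nth_derivative_divided_power divided_power_def)
    also have "\<dots> = ?G $$ (i, k)" using k by simp
    finally show "?G $$ (i, k) = 0" by simp
  next
    fix j assume j: "j < 2 * r"
    let ?w = "vseq (p + 2 * r) (\<lambda>x. exp (freq lam j * complex_of_real x))"
    have "0 = (?G *\<^sub>v ?w 0) $ i"
      using horner_annihilates_orbit[where C = C and w = ?w, OF C supp v transition_vseq_exp[OF j]]
        ann exp_in_Vspace[OF j] i by simp
    also have "\<dots> = (\<Sum>l<n. ?G $$ (i, l) * ?w 0 $ l)" by (rule mult_mat_vec_nth[OF G v i])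
    also have "\<dots> = (\<Sum>l<n. ?G $$ (i, l) * freq lam j ^ l)"
      by (rule sum.cong) (auto simp: vseq_def nth_derivative_exp)
    finally show "(\<Sum>l<n. ?G $$ (i, l) * freq lam j ^ l) = 0" by simp
  }
qed

end

theorem theorem20:
  fixes p r d :: nat and lam :: "nat \<Rightarrow> complex" and C :: "int \<Rightarrow> real mat"
  assumes "r \<ge> 1" and "d = p + 2 * r" and "frequencies r lam"
    and "C \<in> ell00 (d + 1)"
    and "\<forall>f\<in>Vspace p r lam. conv_vec (d + 1) (complex_mask C) (vseq d f) = (\<lambda>\<alpha>. 0\<^sub>v (d + 1))"
  shows "\<exists>B :: int \<Rightarrow> real mat. B \<in> ell00 (d + 1) \<and>
           complex_mask C = conv_mat (d + 1) (complex_mask B) (Hmask p r lam)"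
proof -
  let ?n = "d + 1"
  define S where "S = {\<alpha>. C \<alpha> \<noteq> 0\<^sub>m ?n ?n}"
  have C: "\<And>\<alpha>. C \<alpha> \<in> carrier_mat ?n ?n" and "finite S"
    using assms(4) by (auto simp: ell00_def S_def)
  define N where "N = Max (insert 0 (abs ` S)) + 1"
  have "\<bar>\<alpha>\<bar> < N" if "\<alpha> \<in> insert 0 S" for \<alpha>
    using Max_ge[of "insert 0 (abs ` S)" "\<bar>\<alpha>\<bar>"] \<open>finite S\<close> that by (auto simp: N_def)
  then have N: "\<And>\<alpha>. \<alpha> \<in> S \<Longrightarrow> \<bar>\<alpha>\<bar> < N" and N0: "N > 0" by force+
  define K where "K = nat (2 * N)"
  define E where "E = map_mat Re (transition p r lam)"
  have tr: "transition p r lam \<in> carrier_mat ?n ?n"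
    using transition_carrier[OF assms(3)] assms(2) by simp
  then have E: "E \<in> carrier_mat ?n ?n" by (simp add: E_def)
  have realE: "map_mat complex_of_real E = transition p r lam"
    unfolding E_def by (rule transition_real[OF assms(3)])
  \<comment> \<open>The index 0 of the Horner scheme corresponds to the position \<open>-N\<close>, to the left of which
    \<open>nat\<close> truncates to 0 and \<open>B\<close> vanishes.\<close>
  define G where "G = horner ?n E (\<lambda>l. C (int l - N))"
  define B where "B \<alpha> = G (nat (\<alpha> + N))" for \<alpha>
  have G: "G k \<in> carrier_mat ?n ?n" for k
    unfolding G_def by (rule horner_carrier[where c = "\<lambda>l. C (int l - N)", OF E C])
  have Bc: "B \<alpha> \<in> carrier_mat ?n ?n" for \<alpha> unfolding B_def by (rule G)
  have C0: "C \<alpha> = 0\<^sub>m ?n ?n" if "\<alpha> < - N \<or> \<alpha> \<ge> N" for \<alpha>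
    using N[of \<alpha>] that by (force simp: S_def)
  have KN: "int K - N = N" using N0 by (simp add: K_def)
  have "map_mat complex_of_real (G K) = 0\<^sub>m ?n ?n"
  proof -
    have "map_mat complex_of_real (G K) =
        horner ?n (transition p r lam) (\<lambda>l. complex_mask C (int l - N)) K"
      unfolding G_def complex_mask_def
      using map_mat_horner[where c = "\<lambda>l. C (int l - N)", OF E C] by (simp add: realE)
    also have "\<dots> = 0\<^sub>m ?n ?n"
      unfolding assms(2)
    proof (rule horner_remainder_zero[OF assms(3)])
      show "complex_mask C \<beta> \<in> carrier_mat (p + 2 * r + 1) (p + 2 * r + 1)" for \<beta>
        using C[of \<beta>] assms(2) by (simp add: complex_mask_def)
      show "- N \<le> \<beta> \<and> \<beta> < int K - N"
        if nz: "complex_mask C \<beta> \<noteq> 0\<^sub>m (p + 2 * r + 1) (p + 2 * r + 1)" for \<beta>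
      proof (rule ccontr)
        assume "\<not> (- N \<le> \<beta> \<and> \<beta> < int K - N)"
        then have "C \<beta> = 0\<^sub>m ?n ?n" using C0[of \<beta>] KN by auto
        with nz assms(2) show False by (auto simp: complex_mask_def)
      qed
    qed (use assms(2,5) in simp)
    finally show ?thesis .
  qed
  then have "complex_of_real (G K $$ (i, j)) = 0" if "i < ?n" "j < ?n" for i j
    using that G[of K] by (metis carrier_matD index_map_mat(1) index_zero_mat(1))
  then have "G K = 0\<^sub>m ?n ?n" using G[of K] by (intro eq_matI) auto
  then have Gz: "G k = 0\<^sub>m ?n ?n" if "k \<ge> K" for k
    unfolding G_def by (rule horner_eventually_zero[OF E]) (use that C0 KN in auto)
  have "{\<alpha>. B \<alpha> \<noteq> 0\<^sub>m ?n ?n} \<subseteq> {- N..N}"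
  proof (rule subsetI, rule ccontr)
    fix \<alpha> assume "\<alpha> \<in> {\<alpha>. B \<alpha> \<noteq> 0\<^sub>m ?n ?n}" and out: "\<alpha> \<notin> {- N..N}"
    moreover have "nat (\<alpha> + N) = 0 \<or> nat (\<alpha> + N) \<ge> K" using out by (auto simp: K_def)
    ultimately show False using Gz by (auto simp: B_def G_def)
  qed
  then have "B \<in> ell00 ?n" using Bc finite_subset by (auto simp: ell00_def)
  moreover have "complex_mask C = conv_mat ?n (complex_mask B) (Hmask p r lam)"
  proof
    fix \<alpha>
    have rec: "B (\<alpha> + 1) = C \<alpha> + B \<alpha> * E"
    proof (cases "\<alpha> \<ge> - N")
      case True
      then have "nat (\<alpha> + 1 + N) = Suc (nat (\<alpha> + N))" "int (nat (\<alpha> + N)) - N = \<alpha>" by auto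
      then show ?thesis by (simp add: B_def G_def)
    next
      case False
      then show ?thesis using C0[of \<alpha>] E by (simp add: B_def G_def)
    qed
    let ?c = "map_mat complex_of_real"
    have BE: "?c (B \<alpha> * E) = ?c (B \<alpha>) * transition p r lam"
      by (simp only: of_real_hom.mat_hom_mult[OF Bc E] realE)
    have "conv_mat ?n (complex_mask B) (Hmask p r lam) \<alpha> = ?c (B (\<alpha> + 1)) - ?c (B \<alpha>) * transition p r lam"
      using conv_mat_Hmask[OF assms(3), of "complex_mask B"] Bc assms(2) by (simp add: complex_mask_def)
    also have "\<dots> = ?c (C \<alpha>)"
      unfolding BE[symmetric] rec by (rule eq_matI) (use C[of \<alpha>] Bc[of \<alpha>] E in auto)
    finally show "complex_mask C \<alpha> = conv_mat ?n (complex_mask B) (Hmask p r lam) \<alpha>"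
      by (simp add: complex_mask_def)
  qed
  ultimately show ?thesis by blast
qed

end
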